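(* Let $P$ be a polytope with vertex set $V$ and let $\alpha,\beta\in V$. If there exist vertices $\alpha',\beta'\in V\setminus\{\alpha,\beta\}$ such that $\alpha+\beta=\alpha'+\beta'$, then $\operatorname{conv}(\alpha,\beta)$ is not an edge of $P$.
   Context: A polytope is the convex hull of a finite set of points in some $\mathbb{R}^d$; an edge is a 1-dimensional face. *)

theory Defs
  imports "HOL-Analysis.Analysis"
begin

end

theory Submission
  imports Defs
begin

text \<open>The segments from \<alpha> to \<beta> and from \<alpha>' to \<beta>' share their midpoint. If the first one were a face,
  it would therefore contain \<alpha>', which would then lie strictly between \<alpha> and \<beta>, contradicting
  extremality of \<alpha>'.\<close>

theorem lemma1p1:
  fixes P V :: "'a::euclidean_space set" and \<alpha> \<beta> :: 'a
  assumes "polytope P"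
    and "V = {v. v extreme_point_of P}"
    and "\<alpha> \<in> V" and "\<beta> \<in> V"
    and "\<exists>\<alpha>' \<in> V - {\<alpha>, \<beta>}. \<exists>\<beta>' \<in> V - {\<alpha>, \<beta>}. \<alpha> + \<beta> = \<alpha>' + \<beta>'"
  shows "\<not> (convex hull {\<alpha>, \<beta>}) edge_of P"
proof
  assume "(convex hull {\<alpha>, \<beta>}) edge_of P"
  then have face: "closed_segment \<alpha> \<beta> face_of P"
    by (simp add: edge_of_def segment_convex_hull)
  obtain \<alpha>' \<beta>' where \<alpha>': "\<alpha>' extreme_point_of P" "\<alpha>' \<noteq> \<alpha>" "\<alpha>' \<noteq> \<beta>"
    and \<beta>': "\<beta>' extreme_point_of P" and sum: "\<alpha> + \<beta> = \<alpha>' + \<beta>'"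
    using assms by blast
  have in_P: "\<alpha> \<in> P" "\<beta> \<in> P" "\<alpha>' \<in> P" "\<beta>' \<in> P"
    using assms \<alpha>' \<beta>' by (auto simp: extreme_point_of_def)
  have "midpoint \<alpha> \<beta> = midpoint \<alpha>' \<beta>'"
    using sum by (simp add: midpoint_def)
  then have mid: "midpoint \<alpha>' \<beta>' \<in> closed_segment \<alpha> \<beta>"
    by (metis midpoint_in_closed_segment)
  have "\<alpha>' \<in> closed_segment \<alpha> \<beta>"
  proof (cases "\<alpha>' = \<beta>'")
    \<comment> \<open>The hypotheses allow \<open>\<alpha>' = \<beta>'\<close>. The open segment is
      then empty, so the face property gives nothing, but the common midpoint is
      \<open>\<alpha>'\<close> itself.\<close>
    case True
    then show ?thesis using mid by simp
  next
    case False
    then have "midpoint \<alpha>' \<beta>' \<in> open_segment \<alpha>' \<beta>'"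
      by simp
    \<comment> \<open>A face containing a point of the open segment between two points of
      \<open>P\<close> contains both endpoints; here that point is the common midpoint.\<close>
    then show ?thesis
      using face_ofD[OF face _ _ _ mid] in_P by blast
  qed
  then have "\<alpha>' \<in> open_segment \<alpha> \<beta>"
    using \<alpha>' by (simp add: open_segment_def)
  then show False
    using \<alpha>' in_P by (auto simp: extreme_point_of_def)
qed

end
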